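(* Let $\psi:[0,1]\to[0,\infty)$ be a non-negative, measurable function and let $\omega_1$ and $\omega_2$ be positive, continuous functions on $\mathbb{R}^+=[0,\infty)$. Then $U_\psi$ defines a bounded operator from $L^1(\omega_1)$ to $L^1(\omega_2)$ if and only if there exists a constant $C$ such that $$\int_0^1\omega_2(s/t)\,\frac{\psi(t)}{t}\,dt\le C\,\omega_1(s)\qquad\text{for every } s\in\mathbb{R}^+ .$$
   Context: $\mathbb{R}^+=[0,\infty)$ with Lebesgue measure. For a positive, continuous function $\omega$ on $\mathbb{R}^+$, $L^1(\omega)$ is the Banach space of (equivalence classes of) complex-valued measurable functions $f$ on $\mathbb{R}^+$ with $\|f\|_{L^1(\omega)}=\int_0^\infty|f(t)|\omega(t)\,dt<\infty$. For a non-negative, measurable function $\psi$ on $[0,1]$, the generalized Hardy-Cesàro operator is $$(U_\psi f)(x)=\int_0^1 f(tx)\psi(t)\,dt=\frac1x\int_0^x f(s)\psi(s/x)\,ds .$$ Saying that $U_\psi$ defines a bounded operator from $L^1(\omega_1)$ to $L^1(\omega_2)$ means that for every $f\in L^1(\omega_1)$ the integral $(U_\psi f)(x)$ is defined (as a Lebesgue integral) for almost all $x\in\mathbb{R}^+$, the function $U_\psi f$ belongs to $L^1(\omega_2)$, and there is a constant $C'$ with $\|U_\psi f\|_{L^1(\omega_2)}\le C'\|f\|_{L^1(\omega_1)}$ for all $f\in L^1(\omega_1)$. *)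

theory Defs
  imports "HOL-Analysis.Analysis"
begin

text \<open>
  Elements of the weighted space are represented by functions rather than by equivalence classes;
  only their values on \<open>[0,\<infinity>)\<close> matter. Measurability is Lebesgue measurability.
\<close>

definition weighted_L1 :: "(real \<Rightarrow> real) \<Rightarrow> (real \<Rightarrow> complex) set" where
  "weighted_L1 \<omega> =
     {f. f \<in> borel_measurable (lebesgue_on {0..}) \<and>
         integrable (lebesgue_on {0..}) (\<lambda>t. norm (f t) * \<omega> t)}"

definition weighted_L1_norm :: "(real \<Rightarrow> real) \<Rightarrow> (real \<Rightarrow> complex) \<Rightarrow> real" where
  "weighted_L1_norm \<omega> f = (LINT t|lebesgue_on {0..}. norm (f t) * \<omega> t)"

definition hardy_cesaro_integrand ::
    "(real \<Rightarrow> real) \<Rightarrow> (real \<Rightarrow> complex) \<Rightarrow> real \<Rightarrow> real \<Rightarrow> complex" where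
  "hardy_cesaro_integrand \<psi> f x t = f (t * x) * complex_of_real (\<psi> t)"

text \<open>
  The Bochner integral is \<open>0\<close> by convention at points \<open>x\<close> where the integrand is not
  integrable; boundedness below therefore demands integrability for almost all \<open>x\<close> explicitly.
\<close>

definition hardy_cesaro :: "(real \<Rightarrow> real) \<Rightarrow> (real \<Rightarrow> complex) \<Rightarrow> real \<Rightarrow> complex" where
  "hardy_cesaro \<psi> f x = (LINT t|lebesgue_on {0..1}. hardy_cesaro_integrand \<psi> f x t)"

definition hardy_cesaro_bounded ::
    "(real \<Rightarrow> real) \<Rightarrow> (real \<Rightarrow> real) \<Rightarrow> (real \<Rightarrow> real) \<Rightarrow> bool" where
  "hardy_cesaro_bounded \<psi> \<omega>1 \<omega>2 \<longleftrightarrow>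
     (\<forall>f \<in> weighted_L1 \<omega>1.
        (AE x in lebesgue_on {0..}.
           integrable (lebesgue_on {0..1}) (hardy_cesaro_integrand \<psi> f x)) \<and>
        hardy_cesaro \<psi> f \<in> weighted_L1 \<omega>2) \<and>
     (\<exists>C'. \<forall>f \<in> weighted_L1 \<omega>1.
        weighted_L1_norm \<omega>2 (hardy_cesaro \<psi> f) \<le> C' * weighted_L1_norm \<omega>1 f)"

end

theory Submission
  imports Defs
begin

text \<open>
  Write \<open>K(s)\<close> for the integral in the condition. Exchanging the order of integration and
  substituting \<open>s = t x\<close> gives
  \<open>\<integral> (\<integral> \<bar>f(t x)\<bar> \<psi>(t) dt) \<omega>2(x) dx = \<integral> \<bar>f(s)\<bar> K(s) ds\<close>, an identity in \<open>[0, \<infinity>]\<close>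
  (lemma \<open>nn_integral_hardy_kernel\<close>): the formal adjoint of the operator turns the weight \<open>\<omega>2\<close>
  into \<open>K\<close>.

  If \<open>K \<le> C \<omega>1\<close>, the right side is at most \<open>C\<close> times the norm of \<open>f\<close>. Its finiteness makes the
  inner integral finite for almost all \<open>x\<close>, and the triangle inequality bounds the norm of the
  image (lemma \<open>hardy_cesaro_bounded_if_kernel_le\<close>).

  Conversely, the triangle inequality is an equality for a non-negative \<open>f\<close>. Testing a bounded
  operator on indicator functions of bounded Borel sets therefore compares the integrals of \<open>K\<close> and
  of \<open>C \<omega>1\<close> over all such sets, so that \<open>K \<le> C \<omega>1\<close> almost everywhere. The condition asks for every
  point \<open>s\<close>. As \<open>\<omega>2\<close> is continuous, Fatou's lemma shows that \<open>K\<close> is lower semicontinuous (lemma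
  \<open>kernel_le_liminf\<close>); as \<open>\<omega>1\<close> is continuous too, the inequality passes from a sequence of good
  points tending to \<open>s\<close> to \<open>s\<close> itself.

  The exchange of integrals needs joint measurability of \<open>(x, t) \<mapsto> f(t x) \<psi>(t)\<close>, which is awkward for
  Lebesgue measurable functions. All computations are made with Borel versions of \<open>f\<close> and \<open>\<psi>\<close>. Since
  a dilation by \<open>x > 0\<close> preserves null sets, this changes the operator at no \<open>x > 0\<close>
  (lemma \<open>hardy_cesaro_representative\<close>).
\<close>

definition weight :: "(real \<Rightarrow> real) \<Rightarrow> bool" where
  "weight \<omega> \<longleftrightarrow> continuous_on {0..} \<omega> \<and> (\<forall>s\<ge>0. 0 < \<omega> s)"

lemma weight_continuous: "weight \<omega> \<Longrightarrow> continuous_on {0..} \<omega>"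
  and weight_pos: "weight \<omega> \<Longrightarrow> 0 \<le> s \<Longrightarrow> 0 < \<omega> s"
  by (simp_all add: weight_def)

section \<open>Borel representatives\<close>

text \<open>
  The completion provides Borel versions of real functions; here they are assembled from the
  coordinates.
\<close>

lemma borel_representative_on:
  fixes f :: "real \<Rightarrow> 'a::euclidean_space"
  assumes f: "f \<in> borel_measurable (lebesgue_on S)" and S: "S \<in> sets lebesgue"
  obtains g where "g \<in> borel_measurable borel" "AE x in lborel. x \<in> S \<longrightarrow> g x = f x"
proof -
  define h where "h x = (if x \<in> S then f x else 0)" for x
  have h: "h \<in> borel_measurable lebesgue"
    unfolding h_def by (rule borel_measurable_if_I[OF f S])
  have "\<exists>k\<in>borel_measurable lborel. AE x in lborel. h x \<bullet> b = k x" for b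
    by (rule completion_ex_borel_measurable_real) (use h in measurable)
  then obtain k where k: "\<And>b. k b \<in> borel_measurable lborel"
    "\<And>b. AE x in lborel. h x \<bullet> b = k b x"
    by metis
  define g where "g x = (\<Sum>b\<in>Basis. k b x *\<^sub>R b)" for x
  have "g \<in> borel_measurable borel"
    unfolding g_def using k(1) by (intro borel_measurable_sum borel_measurable_scaleR) auto
  moreover have "AE x in lborel. \<forall>b\<in>Basis. h x \<bullet> b = k b x"
    using k(2) by (intro AE_finite_allI) auto
  then have "AE x in lborel. x \<in> S \<longrightarrow> g x = f x"
  proof eventually_elim
    case (elim x)
    then have "g x = (\<Sum>b\<in>Basis. (h x \<bullet> b) *\<^sub>R b)" by (simp add: g_def)
    then show ?case by (simp add: euclidean_representation h_def)
  qed
  ultimately show ?thesis by (rule that)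
qed

lemma AE_lborel_scale:
  fixes x :: real
  assumes "AE s in lborel. P s" "x \<noteq> 0"
  shows "AE t in lborel. P (t * x)"
proof -
  obtain N where N: "{s. \<not> P s} \<subseteq> N" "N \<in> sets borel" "emeasure lborel N = 0"
    using AE_E[OF assms(1)] by auto
  have [measurable]: "N \<in> sets borel" by fact
  have "AE s in lborel. s \<notin> N"
    using N by (intro AE_not_in) auto
  from AE_borel_affine[OF assms(2) _ this, of 0]
  have "AE t in lborel. x * t \<notin> N" by simp
  then show ?thesis by eventually_elim (use N(1) in \<open>auto simp: mult.commute\<close>)
qed

lemma nn_integral_lebesgue_on:
  assumes "S \<in> sets lebesgue"
  shows "(\<integral>\<^sup>+x. f x \<partial>lebesgue_on S) = (\<integral>\<^sup>+x. f x * indicator S x \<partial>lborel)"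
  using assms by (simp add: nn_integral_restrict_space nn_integral_completion)

lemma AE_lebesgue_on_iff:
  assumes "S \<in> sets lebesgue"
  shows "(AE x in lebesgue_on S. P x) \<longleftrightarrow> (AE x in lborel. x \<in> S \<longrightarrow> P x)"
  using assms by (simp add: AE_restrict_space_iff AE_completion_iff)

section \<open>The operator in terms of representatives\<close>

text \<open>
  The version is also made to vanish at \<open>0\<close>. Then \<open>s / t\<close> and \<open>p t / t\<close> only matter for \<open>t > 0\<close>, and
  integrals over \<open>[0, 1]\<close> become integrals over the whole line.
\<close>

definition Borel_version :: "(real \<Rightarrow> real) \<Rightarrow> (real \<Rightarrow> real) \<Rightarrow> bool" where
  "Borel_version \<psi> p \<longleftrightarrow> p \<in> borel_measurable borel \<and> (\<forall>t. 0 \<le> p t) \<and>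
     (\<forall>t. t \<notin> {0<..1} \<longrightarrow> p t = 0) \<and> (AE t in lborel. t \<in> {0..1} \<longrightarrow> p t = \<psi> t)"

lemma Borel_version_exists:
  assumes "\<psi> \<in> borel_measurable (lebesgue_on {0..1})" "\<forall>t\<in>{0..1}. 0 \<le> \<psi> t"
  obtains p where "Borel_version \<psi> p"
proof -
  obtain q where [measurable]: "q \<in> borel_measurable borel"
    and q: "AE x in lborel. x \<in> {0..1} \<longrightarrow> q x = \<psi> x"
    using borel_representative_on[OF assms(1)] by auto
  have "(\<lambda>t. indicator {0<..1} t * max 0 (q t)) \<in> borel_measurable borel"
    by measurable
  moreover have "AE t in lborel. t \<in> {0..1} \<longrightarrow> indicator {0<..1} t * max 0 (q t) = \<psi> t"
    using q AE_lborel_singleton[of 0]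
    by eventually_elim (use assms(2) in \<open>auto simp: indicator_def\<close>)
  ultimately show ?thesis
    by (intro that[of "\<lambda>t. indicator {0<..1} t * max 0 (q t)"]) (auto simp: Borel_version_def)
qed

text \<open>
  The integrands agree for almost all \<open>t\<close> because \<open>t \<mapsto> t x\<close> pulls null sets back to null sets.
  Hence the two sides agree for each \<open>x > 0\<close>, not just for almost all.
\<close>

lemma hardy_cesaro_representative:
  assumes p: "Borel_version \<psi> p"
    and g: "g \<in> borel_measurable borel" "AE s in lborel. s \<in> {0..} \<longrightarrow> g s = f s"
    and x: "0 < x"
  shows "integrable (lebesgue_on {0..1}) (hardy_cesaro_integrand \<psi> f x) \<longleftrightarrow>
           integrable lborel (\<lambda>t. g (t * x) * of_real (p t))" (is ?int)
    and "hardy_cesaro \<psi> f x = (LINT t|lborel. g (t * x) * of_real (p t))" (is ?eq)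
proof -
  note [measurable] = g(1)
  have [measurable]: "p \<in> borel_measurable borel" using p by (simp add: Borel_version_def)
  let ?F = "\<lambda>t. indicator {0..1} t *\<^sub>R hardy_cesaro_integrand \<psi> f x t"
  let ?G = "\<lambda>t. g (t * x) * of_real (p t)"
  have G [measurable]: "?G \<in> borel_measurable lborel" by measurable
  have p0: "\<And>t. t \<notin> {0..1} \<Longrightarrow> p t = 0" using p by (auto simp: Borel_version_def)
  have "AE t in lborel. t \<in> {0..1} \<longrightarrow> p t = \<psi> t" using p by (simp add: Borel_version_def)
  moreover have "AE t in lborel. t * x \<in> {0..} \<longrightarrow> g (t * x) = f (t * x)"
    using AE_lborel_scale[OF g(2)] x by simp
  ultimately have "AE t in lborel. ?G t = ?F t"
    by eventually_elim (use x in \<open>auto simp: hardy_cesaro_integrand_def indicator_def p0\<close>)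
  then have ae: "AE t in lebesgue. ?G t = ?F t" by (rule AE_completion)
  have G': "?G \<in> borel_measurable lebesgue" by (rule measurable_completion[OF G])
  have F': "?F \<in> borel_measurable lebesgue" by (rule borel_measurable_AE[OF G' ae])
  have "integrable lebesgue ?F \<longleftrightarrow> integrable lebesgue ?G"
    using ae by (intro integrable_cong_AE F' G') auto
  then show ?int by (simp add: integrable_restrict_space integrable_completion)
  have "integral\<^sup>L lebesgue ?F = integral\<^sup>L lebesgue ?G"
    using ae by (intro integral_cong_AE F' G') auto
  then show ?eq
    by (simp add: hardy_cesaro_def integral_restrict_space integral_completion)
qed

text \<open>
  For \<open>x > 0\<close> the image is a parametrized integral of a jointly Borel function; the value at \<open>x = 0\<close>
  depends on \<open>f 0\<close> itself and is treated as a separate constant.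
\<close>

lemma hardy_cesaro_measurable:
  assumes p: "Borel_version \<psi> p"
    and g: "g \<in> borel_measurable borel" "AE s in lborel. s \<in> {0..} \<longrightarrow> g s = f s"
  shows "hardy_cesaro \<psi> f \<in> borel_measurable (lebesgue_on {0..})"
proof -
  note [measurable] = g(1)
  have [measurable]: "p \<in> borel_measurable borel" using p by (simp add: Borel_version_def)
  have "(\<lambda>x. if x = 0 then hardy_cesaro \<psi> f 0 else LINT t|lborel. g (t * x) * of_real (p t))
     \<in> borel_measurable borel" (is "?H \<in> _")
    by measurable
  then have "?H \<in> borel_measurable (lebesgue_on {0..})"
    by (intro measurable_restrict_space1 measurable_completion) simp
  also have "?this \<longleftrightarrow> ?thesis"
    using hardy_cesaro_representative(2)[OF p g]
    by (intro measurable_cong) (auto simp: space_restrict_space less_le)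
  finally show ?thesis .
qed

section \<open>Duality with the kernel\<close>

text \<open>The density with respect to \<open>ds\<close> of the measure to which the adjoint operator sends \<open>\<omega> dx\<close>.\<close>

definition hardy_kernel :: "(real \<Rightarrow> real) \<Rightarrow> (real \<Rightarrow> real) \<Rightarrow> real \<Rightarrow> ennreal" where
  "hardy_kernel \<psi> \<omega> s = (\<integral>\<^sup>+ t. ennreal (\<omega> (s / t) * (\<psi> t / t)) \<partial>lebesgue_on {0..1})"

text \<open>Tonelli's theorem, with the substitution \<open>s = t x\<close> in the inner integral for each \<open>t > 0\<close>.\<close>

lemma nn_integral_dilation_adjoint:
  fixes G w :: "real \<Rightarrow> ennreal" and p :: "real \<Rightarrow> real"
  assumes [measurable]: "G \<in> borel_measurable borel" "w \<in> borel_measurable borel"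
      "p \<in> borel_measurable borel"
    and p: "\<forall>t. 0 \<le> p t" "\<forall>t\<le>0. p t = 0"
  shows "(\<integral>\<^sup>+x. (\<integral>\<^sup>+t. G (t * x) * ennreal (p t) \<partial>lborel) * w x \<partial>lborel) =
         (\<integral>\<^sup>+s. G s * (\<integral>\<^sup>+t. w (s / t) * ennreal (p t / t) \<partial>lborel) \<partial>lborel)"
proof -
  have scale: "(\<integral>\<^sup>+x. G (t * x) * ennreal (p t) * w x \<partial>lborel) =
      (\<integral>\<^sup>+s. G s * (w (s / t) * ennreal (p t / t)) \<partial>lborel)" for t
  proof (cases "t \<le> 0")
    case False
    have "(\<integral>\<^sup>+x. G (t * x) * ennreal (p t) * w x \<partial>lborel) =
       ennreal \<bar>1 / t\<bar> * (\<integral>\<^sup>+s. G (t * (0 + 1 / t * s)) * ennreal (p t) * w (0 + 1 / t * s) \<partial>lborel)"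
      using False by (intro nn_integral_real_affine) auto
    also have "\<dots> = (\<integral>\<^sup>+s. ennreal \<bar>1 / t\<bar> * (G s * ennreal (p t) * w (s / t)) \<partial>lborel)"
      using False by (simp add: nn_integral_cmult)
    also have "\<dots> = (\<integral>\<^sup>+s. G s * (w (s / t) * ennreal (p t / t)) \<partial>lborel)"
    proof (rule nn_integral_cong)
      fix s
      have "ennreal (p t / t) = ennreal \<bar>1 / t\<bar> * ennreal (p t)"
        using False p(1) by (simp flip: ennreal_mult')
      then show "ennreal \<bar>1 / t\<bar> * (G s * ennreal (p t) * w (s / t)) =
          G s * (w (s / t) * ennreal (p t / t))"
        by (simp add: mult_ac)
    qed
    finally show ?thesis .
  qed (simp add: p(2))
  have "(\<integral>\<^sup>+x. (\<integral>\<^sup>+t. G (t * x) * ennreal (p t) \<partial>lborel) * w x \<partial>lborel) =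
      (\<integral>\<^sup>+x. \<integral>\<^sup>+t. G (t * x) * ennreal (p t) * w x \<partial>lborel \<partial>lborel)"
    by (simp add: nn_integral_multc)
  also have "\<dots> = (\<integral>\<^sup>+t. \<integral>\<^sup>+x. G (t * x) * ennreal (p t) * w x \<partial>lborel \<partial>lborel)"
    by (rule lborel_pair.Fubini'[symmetric]) measurable
  also have "\<dots> = (\<integral>\<^sup>+t. \<integral>\<^sup>+s. G s * (w (s / t) * ennreal (p t / t)) \<partial>lborel \<partial>lborel)"
    by (simp only: scale)
  also have "\<dots> = (\<integral>\<^sup>+s. \<integral>\<^sup>+t. G s * (w (s / t) * ennreal (p t / t)) \<partial>lborel \<partial>lborel)"
    by (rule lborel_pair.Fubini') measurable
  also have "\<dots> = (\<integral>\<^sup>+s. G s * (\<integral>\<^sup>+t. w (s / t) * ennreal (p t / t) \<partial>lborel) \<partial>lborel)"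
    by (simp add: nn_integral_cmult)
  finally show ?thesis .
qed

lemma borel_measurable_weight:
  fixes \<omega> :: "real \<Rightarrow> real"
  assumes "weight \<omega>"
  shows "(\<lambda>x. ennreal (\<omega> x) * indicator {0..} x) \<in> borel_measurable borel"
proof -
  have "(\<lambda>x. ennreal (indicator {0..} x *\<^sub>R \<omega> x)) \<in> borel_measurable borel"
    using borel_measurable_continuous_on_indicator[OF _ weight_continuous[OF assms]] by measurable
  also have "(\<lambda>x. ennreal (indicator {0..} x *\<^sub>R \<omega> x)) =
      (\<lambda>x. ennreal (\<omega> x) * indicator {0..} x)"
    by (auto simp: indicator_def)
  finally show ?thesis .
qed

text \<open>
  The weight is cut off to the half-line, where it is controlled. The cut-off also makes the left
  side vanish for \<open>s < 0\<close>, so that the equation holds on the whole line and yields Borel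
  measurability of the right side in \<open>s\<close>.
\<close>

lemma kernel_representative:
  assumes p: "Borel_version \<psi> p" and \<omega>: "weight \<omega>"
  shows "(\<integral>\<^sup>+t. (ennreal (\<omega> (s / t)) * indicator {0..} (s / t)) * ennreal (p t / t) \<partial>lborel) =
    hardy_kernel \<psi> \<omega> s * indicator {0..} s"
proof (cases "0 \<le> s")
  case True
  have p0: "\<And>t. t \<notin> {0<..1} \<Longrightarrow> p t = 0" using p by (auto simp: Borel_version_def)
  have "AE t in lborel. t \<in> {0..1} \<longrightarrow> p t = \<psi> t" using p by (simp add: Borel_version_def)
  then have "AE t in lborel. (ennreal (\<omega> (s / t)) * indicator {0..} (s / t)) * ennreal (p t / t) =
      ennreal (\<omega> (s / t) * (\<psi> t / t)) * indicator {0..1} t"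
  proof eventually_elim
    case (elim t)
    show ?case
    proof (cases "t \<in> {0<..1}")
      case in01: True
      then have "0 \<le> s / t" using True by simp
      moreover have "0 \<le> \<omega> (s / t)" using weight_pos[OF \<omega> \<open>0 \<le> s / t\<close>] by simp
      ultimately show ?thesis
        using elim in01 by (simp add: ennreal_mult'[of "\<omega> (s / t)" "\<psi> t / t"] del: times_divide_eq_right)
    next
      case False
      then show ?thesis using p0[of t] by (cases "t = 0") (auto simp: indicator_def)
    qed
  qed
  then show ?thesis
    using True by (simp add: hardy_kernel_def nn_integral_lebesgue_on nn_integral_cong_AE
        del: times_divide_eq_right)
next
  case False
  have "p t / t = 0 \<or> s / t < 0" for t
    using False p by (cases "t \<in> {0<..1}") (auto simp: Borel_version_def divide_less_0_iff)
  then have zero: "(ennreal (\<omega> (s / t)) * indicator {0..} (s / t)) * ennreal (p t / t) = 0" for t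
    by (metis atLeast_iff ennreal_0 indicator_simps(2) mult_zero_left mult_zero_right not_le)
  show ?thesis unfolding zero using False by simp
qed

lemma borel_measurable_kernel:
  assumes p: "Borel_version \<psi> p" and \<omega>: "weight \<omega>"
  shows "(\<lambda>s. hardy_kernel \<psi> \<omega> s * indicator {0..} s) \<in> borel_measurable borel"
proof -
  have [measurable]: "p \<in> borel_measurable borel" using p by (simp add: Borel_version_def)
  have [measurable]: "(\<lambda>x. ennreal (\<omega> x) * indicator {0..} x) \<in> borel_measurable borel"
    (is "?w \<in> _") by (rule borel_measurable_weight[OF \<omega>])
  have "(\<lambda>s. \<integral>\<^sup>+t. ?w (s / t) * ennreal (p t / t) \<partial>lborel) \<in> borel_measurable borel"
    by measurable
  then show ?thesis by (simp only: kernel_representative[OF p \<omega>])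
qed

text \<open>
  The identity behind both directions. The left side dominates the weighted norm of the image of \<open>g\<close>,
  and equals it when \<open>g\<close> is non-negative and the integrals defining the image converge.
\<close>

lemma nn_integral_hardy_kernel:
  fixes g :: "real \<Rightarrow> complex"
  assumes p: "Borel_version \<psi> p" and \<omega>: "weight \<omega>"
    and [measurable]: "g \<in> borel_measurable borel"
  shows "(\<integral>\<^sup>+x. (\<integral>\<^sup>+t. ennreal (norm (g (t * x) * of_real (p t))) \<partial>lborel) *
            (ennreal (\<omega> x) * indicator {0..} x) \<partial>lborel) =
         (\<integral>\<^sup>+s. ennreal (norm (g s)) * (hardy_kernel \<psi> \<omega> s * indicator {0..} s) \<partial>lborel)"
proof -
  have p0: "\<forall>t. 0 \<le> p t" "\<forall>t\<le>0. p t = 0" and [measurable]: "p \<in> borel_measurable borel"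
    using p by (auto simp: Borel_version_def)
  note [measurable] = borel_measurable_weight[OF \<omega>]
  show ?thesis
    using nn_integral_dilation_adjoint[OF _ borel_measurable_weight[OF \<omega>] _ p0,
        where G = "\<lambda>s. ennreal (norm (g s))"] p0(1)
    by (simp only: kernel_representative[OF p \<omega>] norm_mult norm_of_real abs_of_nonneg
        ennreal_mult' norm_ge_zero) measurable
qed

section \<open>The weighted spaces\<close>

lemma weighted_L1_norm_eq:
  assumes "f \<in> weighted_L1 \<omega>" "weight \<omega>"
  shows "ennreal (weighted_L1_norm \<omega> f) =
    (\<integral>\<^sup>+x. ennreal (norm (f x)) * (ennreal (\<omega> x) * indicator {0..} x) \<partial>lborel)"
proof -
  have "(\<integral>\<^sup>+x. ennreal (norm (f x) * \<omega> x) \<partial>lebesgue_on {0..}) = ennreal (weighted_L1_norm \<omega> f)"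
    unfolding weighted_L1_norm_def
    using assms by (intro nn_integral_eq_integral)
      (auto simp: weighted_L1_def weight_pos less_imp_le intro!: AE_I2)
  then show ?thesis
    by (simp add: nn_integral_lebesgue_on ennreal_mult' mult.assoc)
qed

lemma weighted_L1_norm_nonneg:
  assumes "weight \<omega>"
  shows "0 \<le> weighted_L1_norm \<omega> f"
  unfolding weighted_L1_norm_def
  using weight_pos[OF assms] by (intro integral_nonneg_AE AE_I2) (simp add: less_imp_le)

lemma weighted_L1I:
  assumes f: "f \<in> borel_measurable (lebesgue_on {0..})"
    and \<omega>: "weight \<omega>"
    and fin: "(\<integral>\<^sup>+x. ennreal (norm (f x)) * (ennreal (\<omega> x) * indicator {0..} x) \<partial>lborel) < \<infinity>"
  shows "f \<in> weighted_L1 \<omega>"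
proof -
  have [measurable]: "\<omega> \<in> borel_measurable (lebesgue_on {0..})"
    by (rule continuous_imp_measurable_on_sets_lebesgue[OF weight_continuous[OF \<omega>]]) simp
  note [measurable] = f
  have "(\<integral>\<^sup>+x. ennreal (norm (norm (f x) * \<omega> x)) \<partial>lebesgue_on {0..}) =
      (\<integral>\<^sup>+x. ennreal (norm (f x) * \<omega> x) \<partial>lebesgue_on {0..})"
    using weight_pos[OF \<omega>] by (intro nn_integral_cong) (simp add: less_imp_le)
  also have "\<dots> < \<infinity>"
    using fin by (simp add: nn_integral_lebesgue_on ennreal_mult' mult.assoc)
  finally show ?thesis
    using f by (auto simp: weighted_L1_def integrable_iff_bounded)
qed

section \<open>Sufficiency\<close>

lemma hardy_cesaro_bounded_if_kernel_le:
  assumes \<psi>: "\<psi> \<in> borel_measurable (lebesgue_on {0..1})" "\<forall>t\<in>{0..1}. 0 \<le> \<psi> t"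
    and \<omega>1: "weight \<omega>1"
    and \<omega>2: "weight \<omega>2"
    and C: "0 \<le> C" "\<forall>s\<ge>0. hardy_kernel \<psi> \<omega>2 s \<le> ennreal (C * \<omega>1 s)"
  shows "hardy_cesaro_bounded \<psi> \<omega>1 \<omega>2"
proof -
  obtain p where p: "Borel_version \<psi> p" using Borel_version_exists[OF \<psi>] by auto
  have p_meas [measurable]: "p \<in> borel_measurable borel" using p by (simp add: Borel_version_def)
  have main: "(AE x in lebesgue_on {0..}.
           integrable (lebesgue_on {0..1}) (hardy_cesaro_integrand \<psi> f x)) \<and>
        hardy_cesaro \<psi> f \<in> weighted_L1 \<omega>2 \<and>
        weighted_L1_norm \<omega>2 (hardy_cesaro \<psi> f) \<le> C * weighted_L1_norm \<omega>1 f"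
    if f: "f \<in> weighted_L1 \<omega>1" for f
  proof -
    have "f \<in> borel_measurable (lebesgue_on {0..})" using f by (simp add: weighted_L1_def)
    then obtain g where g: "g \<in> borel_measurable borel" "AE s in lborel. s \<in> {0..} \<longrightarrow> g s = f s"
      by (rule borel_representative_on) simp
    note [measurable] = g(1) borel_measurable_weight[OF \<omega>2]
    note rep = hardy_cesaro_representative[OF p g]
    let ?w = "\<lambda>x. ennreal (\<omega>2 x) * indicator {0..} x"
    let ?N = "\<lambda>x. \<integral>\<^sup>+t. ennreal (norm (g (t * x) * of_real (p t))) \<partial>lborel"
    have "(\<integral>\<^sup>+x. ?N x * ?w x \<partial>lborel) =
        (\<integral>\<^sup>+s. ennreal (norm (g s)) * (hardy_kernel \<psi> \<omega>2 s * indicator {0..} s) \<partial>lborel)"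
      by (rule nn_integral_hardy_kernel[OF p \<omega>2 g(1)])
    also have "\<dots> \<le> (\<integral>\<^sup>+s. ennreal C * (ennreal (norm (f s) * \<omega>1 s) * indicator {0..} s) \<partial>lborel)"
    proof (rule nn_integral_mono_AE, use g(2) in eventually_elim)
      case (elim s)
      show ?case
      proof (cases "0 \<le> s")
        case True
        have "ennreal (norm (g s)) * hardy_kernel \<psi> \<omega>2 s \<le> ennreal (norm (f s)) * ennreal (C * \<omega>1 s)"
          using True elim C(2) by (auto intro!: mult_left_mono)
        also have "\<dots> = ennreal C * ennreal (norm (f s) * \<omega>1 s)"
          using C(1) weight_pos[OF \<omega>1 True] by (simp add: mult_ac flip: ennreal_mult')
        finally show ?thesis using True by simp
      qed simp
    qed
    also have "\<dots> = (\<integral>\<^sup>+s. ennreal C * ennreal (norm (f s) * \<omega>1 s) \<partial>lebesgue_on {0..})"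
      by (simp add: nn_integral_lebesgue_on mult.assoc)
    also have "\<dots> = ennreal C * (\<integral>\<^sup>+s. ennreal (norm (f s) * \<omega>1 s) \<partial>lebesgue_on {0..})"
      using f by (intro nn_integral_cmult) (auto simp: weighted_L1_def)
    also have "\<dots> = ennreal C * ennreal (weighted_L1_norm \<omega>1 f)"
      using weighted_L1_norm_eq[OF f \<omega>1]
      by (simp add: nn_integral_lebesgue_on ennreal_mult' mult.assoc)
    finally have bound: "(\<integral>\<^sup>+x. ?N x * ?w x \<partial>lborel) \<le> ennreal (C * weighted_L1_norm \<omega>1 f)"
      using C(1) by (simp add: ennreal_mult')
    \<comment> \<open>A finite integral and a positive weight leave the inner integral finite almost everywhere.\<close>
    have "AE x in lborel. ?N x * ?w x \<noteq> \<infinity>"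
      using bound by (intro nn_integral_PInf_AE) (auto simp: top_unique)
    with AE_lborel_singleton[of 0]
    have int: "AE x in lborel. x \<in> {0..} \<longrightarrow> x > 0 \<and> integrable lborel (\<lambda>t. g (t * x) * of_real (p t))"
    proof eventually_elim
      case (elim x)
      show ?case
      proof
        assume "x \<in> {0..}"
        then have "x > 0" using elim by auto
        then have "ennreal (\<omega>2 x) \<noteq> 0" using weight_pos[OF \<omega>2, of x] by (simp add: ennreal_eq_0_iff)
        with elim \<open>x > 0\<close> have "?N x < \<infinity>"
          by (auto simp: ennreal_mult_eq_top_iff less_top)
        with \<open>x > 0\<close> show "x > 0 \<and> integrable lborel (\<lambda>t. g (t * x) * of_real (p t))"
          by (simp add: integrable_iff_bounded)
      qed
    qed
    have ae: "AE x in lebesgue_on {0..}.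
        integrable (lebesgue_on {0..1}) (hardy_cesaro_integrand \<psi> f x)"
    proof -
      have "AE x in lborel. x \<in> {0..} \<longrightarrow>
          integrable (lebesgue_on {0..1}) (hardy_cesaro_integrand \<psi> f x)"
        using int by eventually_elim (auto simp: rep)
      then show ?thesis by (simp add: AE_lebesgue_on_iff)
    qed
    have "(\<integral>\<^sup>+x. ennreal (norm (hardy_cesaro \<psi> f x)) * ?w x \<partial>lborel) \<le> (\<integral>\<^sup>+x. ?N x * ?w x \<partial>lborel)"
    proof (rule nn_integral_mono_AE, use int in eventually_elim)
      case (elim x)
      show ?case
      proof (cases "x \<in> {0..}")
        case True
        with elim have "ennreal (norm (hardy_cesaro \<psi> f x)) \<le> ?N x"
          using integral_norm_bound_ennreal[of lborel "\<lambda>t. g (t * x) * of_real (p t)"]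
          by (simp add: rep(2))
        then show ?thesis by (rule mult_right_mono) simp
      qed simp
    qed
    with bound have bound': "(\<integral>\<^sup>+x. ennreal (norm (hardy_cesaro \<psi> f x)) * ?w x \<partial>lborel)
        \<le> ennreal (C * weighted_L1_norm \<omega>1 f)"
      by (rule order_trans[rotated])
    then have U: "hardy_cesaro \<psi> f \<in> weighted_L1 \<omega>2"
      by (intro weighted_L1I hardy_cesaro_measurable[OF p g] \<omega>2) (auto simp: le_less_trans)
    have "weighted_L1_norm \<omega>2 (hardy_cesaro \<psi> f) \<le> C * weighted_L1_norm \<omega>1 f"
      using bound' C(1) weighted_L1_norm_nonneg[OF \<omega>1]
      by (simp flip: weighted_L1_norm_eq[OF U \<omega>2])
    with ae U show ?thesis by blast
  qed
  then show ?thesis unfolding hardy_cesaro_bounded_def by blast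
qed

section \<open>Necessity\<close>

text \<open>
  The test function is the indicator of \<open>A\<close>. Boundedness of \<open>A\<close> puts it into the space, as \<open>\<omega>1\<close> is
  bounded on compact intervals. It is non-negative, so the norm of its image is computed exactly
  by the kernel. The absolute value of \<open>C\<close> appears because the operator bound may come with any
  real constant.
\<close>

lemma nn_integral_kernel_le_on_bounded_set:
  assumes p: "Borel_version \<psi> p"
    and \<omega>1: "weight \<omega>1"
    and \<omega>2: "weight \<omega>2"
    and bounded: "hardy_cesaro_bounded \<psi> \<omega>1 \<omega>2"
    and C: "\<forall>f\<in>weighted_L1 \<omega>1.
           weighted_L1_norm \<omega>2 (hardy_cesaro \<psi> f) \<le> C * weighted_L1_norm \<omega>1 f"
    and A: "A \<in> sets borel" "A \<subseteq> {0..n}"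
  shows "(\<integral>\<^sup>+s. hardy_kernel \<psi> \<omega>2 s * indicator A s \<partial>lborel)
          \<le> (\<integral>\<^sup>+s. ennreal (\<bar>C\<bar> * \<omega>1 s) * indicator A s \<partial>lborel)" (is ?le)
    and "(\<integral>\<^sup>+s. ennreal (\<bar>C\<bar> * \<omega>1 s) * indicator A s \<partial>lborel) < \<infinity>" (is ?fin)
proof -
  have p0: "\<And>t. 0 \<le> p t" and [measurable]: "p \<in> borel_measurable borel"
    using p by (auto simp: Borel_version_def)
  note [measurable] = A(1)
  have [measurable]: "(\<lambda>x. ennreal (\<omega>1 x) * indicator {0..} x) \<in> borel_measurable borel"
    by (rule borel_measurable_weight[OF \<omega>1])
  define f :: "real \<Rightarrow> complex" where "f s = of_real (indicator A s)" for s
  have f [measurable]: "f \<in> borel_measurable borel" unfolding f_def by measurable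
  have f_meas: "f \<in> borel_measurable (lebesgue_on {0..})"
    by (intro measurable_restrict_space1 measurable_completion) simp
  have fw: "ennreal (norm (f s)) * (a * indicator {0..} s) = a * indicator A s" for s a
    using A(2) by (auto simp: f_def indicator_def)
  obtain M where M: "\<And>s. s \<in> {0..n} \<Longrightarrow> \<omega>1 s \<le> M"
  proof -
    have "compact (\<omega>1 ` {0..n})"
      by (intro compact_continuous_image continuous_on_subset[OF weight_continuous[OF \<omega>1]]) auto
    then have "bdd_above (\<omega>1 ` {0..n})"
      by (intro bounded_imp_bdd_above compact_imp_bounded)
    then obtain M where "\<forall>x\<in>{0..n}. \<omega>1 x \<le> M" by (auto simp: bdd_above_def)
    then show ?thesis using that by blast
  qed
  have "(\<integral>\<^sup>+s. ennreal (\<omega>1 s) * indicator A s \<partial>lborel) \<le> (\<integral>\<^sup>+s. ennreal M * indicator {0..n} s \<partial>lborel)"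
    using M A(2) by (intro nn_integral_mono) (auto simp: indicator_def intro!: ennreal_leI)
  also have "\<dots> < \<infinity>"
    by (simp add: nn_integral_cmult_indicator ennreal_mult_less_top emeasure_lborel_Icc_eq)
  finally have fin: "(\<integral>\<^sup>+s. ennreal (\<omega>1 s) * indicator A s \<partial>lborel) < \<infinity>" .
  have fL: "f \<in> weighted_L1 \<omega>1"
    by (intro weighted_L1I f_meas \<omega>1) (use fin in \<open>simp only: fw\<close>)
  have nf: "ennreal (weighted_L1_norm \<omega>1 f) = (\<integral>\<^sup>+s. ennreal (\<omega>1 s) * indicator A s \<partial>lborel)"
    using weighted_L1_norm_eq[OF fL \<omega>1] by (simp only: fw)
  have rhs: "(\<integral>\<^sup>+s. ennreal (\<bar>C\<bar> * \<omega>1 s) * indicator A s \<partial>lborel) =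
      ennreal (\<bar>C\<bar> * weighted_L1_norm \<omega>1 f)"
  proof -
    have "(\<integral>\<^sup>+s. ennreal (\<bar>C\<bar> * \<omega>1 s) * indicator A s \<partial>lborel) =
       (\<integral>\<^sup>+s. ennreal \<bar>C\<bar> * (ennreal (norm (f s)) * (ennreal (\<omega>1 s) * indicator {0..} s)) \<partial>lborel)"
      unfolding fw by (simp add: ennreal_mult' mult.assoc)
    also have "\<dots> = ennreal \<bar>C\<bar> *
        (\<integral>\<^sup>+s. ennreal (norm (f s)) * (ennreal (\<omega>1 s) * indicator {0..} s) \<partial>lborel)"
      by (rule nn_integral_cmult) measurable
    also have "\<dots> = ennreal \<bar>C\<bar> * (\<integral>\<^sup>+s. ennreal (\<omega>1 s) * indicator A s \<partial>lborel)"
      by (simp only: fw)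
    finally show ?thesis by (simp add: ennreal_mult' flip: nf)
  qed
  show ?fin unfolding rhs by simp
  note rep = hardy_cesaro_representative[OF p f, of f, simplified]
  have "(\<integral>\<^sup>+s. hardy_kernel \<psi> \<omega>2 s * indicator A s \<partial>lborel) =
      (\<integral>\<^sup>+s. ennreal (norm (f s)) * (hardy_kernel \<psi> \<omega>2 s * indicator {0..} s) \<partial>lborel)"
    by (simp only: fw)
  also have "\<dots> = (\<integral>\<^sup>+x. (\<integral>\<^sup>+t. ennreal (norm (f (t * x) * of_real (p t))) \<partial>lborel) *
            (ennreal (\<omega>2 x) * indicator {0..} x) \<partial>lborel)"
    by (rule nn_integral_hardy_kernel[OF p \<omega>2 f, symmetric])
  also have "\<dots> = (\<integral>\<^sup>+x. ennreal (norm (hardy_cesaro \<psi> f x)) *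
            (ennreal (\<omega>2 x) * indicator {0..} x) \<partial>lborel)"
  proof (rule nn_integral_cong_AE)
    have "AE x in lborel. x \<in> {0..} \<longrightarrow>
        integrable (lebesgue_on {0..1}) (hardy_cesaro_integrand \<psi> f x)"
      using bounded fL by (simp add: hardy_cesaro_bounded_def AE_lebesgue_on_iff)
    with AE_lborel_singleton[of 0]
    show "AE x in lborel. (\<integral>\<^sup>+t. ennreal (norm (f (t * x) * of_real (p t))) \<partial>lborel) *
            (ennreal (\<omega>2 x) * indicator {0..} x) = ennreal (norm (hardy_cesaro \<psi> f x)) *
            (ennreal (\<omega>2 x) * indicator {0..} x)"
    proof eventually_elim
      case (elim x)
      show ?case
      proof (cases "0 \<le> x")
        case True
        then have x: "x > 0" using elim by auto
        let ?r = "\<lambda>t. indicator A (t * x) * p t"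
        have r: "f (t * x) * of_real (p t) = complex_of_real (?r t)" for t
          by (simp add: f_def)
        have r0: "0 \<le> ?r t" for t using p0[of t] by (simp add: indicator_def)
        have "integrable lborel (\<lambda>t. complex_of_real (?r t))"
          using elim True x rep(1)[OF x] by (simp add: r)
        then have ir: "integrable lborel ?r" by (simp only: complex_of_real_integrable_eq)
        have "hardy_cesaro \<psi> f x = complex_of_real (LINT t|lborel. ?r t)"
          unfolding rep(2)[OF x] r by (rule integral_complex_of_real)
        then have "ennreal (norm (hardy_cesaro \<psi> f x)) = ennreal (LINT t|lborel. ?r t)"
          using r0 by (simp add: integral_nonneg_AE del: of_real_mult)
        also have "\<dots> = (\<integral>\<^sup>+t. ennreal (norm (f (t * x) * of_real (p t))) \<partial>lborel)"
          unfolding r norm_of_real using r0 nn_integral_eq_integral[OF ir] by simp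
        finally show ?thesis by simp
      qed simp
    qed
  qed
  also have "\<dots> = ennreal (weighted_L1_norm \<omega>2 (hardy_cesaro \<psi> f))"
    using bounded fL
    by (intro weighted_L1_norm_eq[OF _ \<omega>2, symmetric]) (simp add: hardy_cesaro_bounded_def)
  also have "\<dots> \<le> ennreal (\<bar>C\<bar> * weighted_L1_norm \<omega>1 f)"
    using C[rule_format, OF fL] weighted_L1_norm_nonneg[OF \<omega>1, of f]
    by (intro ennreal_leI) (meson abs_ge_self mult_right_mono order_trans)
  finally show ?le unfolding rhs .
qed

text \<open>
  On the part of \<open>[0, n]\<close> where \<open>v < k\<close>, a set of positive measure would make the integral of \<open>k\<close>
  strictly larger than that of \<open>v\<close>; this is where the finiteness of the integral of \<open>v\<close> enters.
\<close>

lemma AE_le_if_nn_integral_le_on_bounded_sets: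
  fixes k v :: "real \<Rightarrow> ennreal"
  assumes [measurable]: "k \<in> borel_measurable borel" "v \<in> borel_measurable borel"
    and le: "\<And>A n. A \<in> sets borel \<Longrightarrow> A \<subseteq> {0..n} \<Longrightarrow>
        (\<integral>\<^sup>+s. k s * indicator A s \<partial>lborel) \<le> (\<integral>\<^sup>+s. v s * indicator A s \<partial>lborel)"
    and fin: "\<And>A n. A \<in> sets borel \<Longrightarrow> A \<subseteq> {0..n} \<Longrightarrow>
        (\<integral>\<^sup>+s. v s * indicator A s \<partial>lborel) < \<infinity>"
  shows "AE s in lborel. 0 \<le> s \<longrightarrow> k s \<le> v s"
proof -
  have "AE s in lborel. s \<in> {0..real n} \<longrightarrow> k s \<le> v s" for n
  proof -
    define A where "A = {s \<in> {0..real n}. v s < k s}"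
    have "{s \<in> space borel. s \<in> {0..real n} \<and> v s < k s} \<in> sets borel" by measurable
    then have A [measurable]: "A \<in> sets borel" by (simp add: A_def)
    have An: "A \<subseteq> {0..real n}" by (auto simp: A_def)
    have "AE s in lborel. k s * indicator A s \<le> v s * indicator A s"
    proof (rule ccontr)
      assume "\<not> ?thesis"
      then have "(\<integral>\<^sup>+s. v s * indicator A s \<partial>lborel) < (\<integral>\<^sup>+s. k s * indicator A s \<partial>lborel)"
        using fin[OF A An] by (intro nn_integral_less) (auto simp: A_def indicator_def)
      with le[OF A An] show False by simp
    qed
    then show ?thesis
      by eventually_elim (fastforce simp: A_def indicator_def not_less[symmetric])
  qed
  then have "AE s in lborel. \<forall>n. s \<in> {0..real n} \<longrightarrow> k s \<le> v s"
    by (simp only: AE_all_countable) blast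
  then show ?thesis
    by eventually_elim (meson atLeastAtMost_iff real_arch_simple)
qed

text \<open>The intervals \<open>(s, s + 1/(n+1))\<close> have positive measure, hence each contains a good point.\<close>

lemma AE_nonneg_approximants:
  assumes "AE s in lborel. 0 \<le> s \<longrightarrow> P s" and s: "(0::real) \<le> s"
  obtains u where "\<And>n::nat. 0 \<le> u n" "\<And>n. P (u n)" "u \<longlonglongrightarrow> s"
proof -
  have "\<exists>y. s < y \<and> y < s + 1 / real (Suc n) \<and> P y" for n
  proof (rule ccontr)
    assume *: "\<not> ?thesis"
    have "AE y in lborel. y \<notin> {s<..<s + 1 / real (Suc n)}"
      using assms(1) by eventually_elim (use * s in auto)
    then have "{s<..<s + 1 / real (Suc n)} \<in> null_sets lborel"
      by (subst AE_iff_null_sets) auto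
    then show False by (simp add: null_sets_def)
  qed
  then obtain u where u: "\<And>n. s < u n" "\<And>n. u n < s + 1 / real (Suc n)" "\<And>n. P (u n)" by metis
  have "u \<longlonglongrightarrow> s"
  proof (rule tendsto_sandwich[of "\<lambda>_. s"])
    show "(\<lambda>n. s + 1 / real (Suc n)) \<longlonglongrightarrow> s"
      using tendsto_add[OF tendsto_const LIMSEQ_inverse_real_of_nat, of s]
      by (simp add: inverse_eq_divide)
  qed (simp_all only: u less_imp_le eventually_True tendsto_const)
  then show ?thesis using u s by (intro that[of u]) (auto simp: less_imp_le intro: order_trans)
qed

text \<open>
  Lower semicontinuity along sequences: the integrands converge for each \<open>t > 0\<close> by continuity of
  \<open>\<omega>\<close>, and Fatou's lemma applies.
\<close>

lemma kernel_le_liminf: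
  assumes p: "Borel_version \<psi> p"
    and \<omega>: "weight \<omega>"
    and u: "\<And>n. 0 \<le> u n" "u \<longlonglongrightarrow> s"
  shows "hardy_kernel \<psi> \<omega> s \<le> liminf (\<lambda>n. hardy_kernel \<psi> \<omega> (u n))"
proof -
  have s: "0 \<le> s" using u by (intro LIMSEQ_le_const) auto
  have [measurable]: "p \<in> borel_measurable borel" and p0: "\<And>t. t \<le> 0 \<Longrightarrow> p t = 0"
    using p by (auto simp: Borel_version_def)
  let ?w = "\<lambda>x. ennreal (\<omega> x) * indicator {0..} x"
  have [measurable]: "?w \<in> borel_measurable borel" by (rule borel_measurable_weight[OF \<omega>])
  have K: "hardy_kernel \<psi> \<omega> y = (\<integral>\<^sup>+t. ?w (y / t) * ennreal (p t / t) \<partial>lborel)" if "0 \<le> y" for y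
    using kernel_representative[OF p \<omega>, where s = y] that by simp
  have "(\<lambda>n. ?w (u n / t) * ennreal (p t / t)) \<longlonglongrightarrow> ?w (s / t) * ennreal (p t / t)" for t
  proof (cases "t \<le> 0")
    case False
    have "(\<lambda>n. \<omega> (u n / t)) \<longlonglongrightarrow> \<omega> (s / t)"
      using False u s by (intro continuous_on_tendsto_compose[OF weight_continuous[OF \<omega>]] tendsto_divide) auto
    then show ?thesis
      using False u(1) s weight_pos[OF \<omega>, of "s / t"]
      by (auto simp: zero_le_divide_iff intro!: tendsto_mult_ennreal tendsto_ennrealI
          simp: ennreal_eq_0_iff)
  qed (simp add: p0)
  then have lim: "?w (s / t) * ennreal (p t / t) =
      liminf (\<lambda>n. ?w (u n / t) * ennreal (p t / t))" for t
    by (intro lim_imp_Liminf[symmetric]) auto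
  have "hardy_kernel \<psi> \<omega> s = (\<integral>\<^sup>+t. liminf (\<lambda>n. ?w (u n / t) * ennreal (p t / t)) \<partial>lborel)"
    unfolding K[OF s] by (simp only: lim)
  also have "\<dots> \<le> liminf (\<lambda>n. \<integral>\<^sup>+t. ?w (u n / t) * ennreal (p t / t) \<partial>lborel)"
    by (rule nn_integral_liminf) measurable
  finally show ?thesis by (simp only: K[OF u(1)])
qed

lemma kernel_le_if_hardy_cesaro_bounded:
  assumes \<psi>: "\<psi> \<in> borel_measurable (lebesgue_on {0..1})" "\<forall>t\<in>{0..1}. 0 \<le> \<psi> t"
    and \<omega>1: "weight \<omega>1"
    and \<omega>2: "weight \<omega>2"
    and bounded: "hardy_cesaro_bounded \<psi> \<omega>1 \<omega>2"
  shows "\<exists>C\<ge>0. \<forall>s\<ge>0. hardy_kernel \<psi> \<omega>2 s \<le> ennreal (C * \<omega>1 s)"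
proof -
  obtain p where p: "Borel_version \<psi> p" using Borel_version_exists[OF \<psi>] by auto
  obtain C where C: "\<forall>f\<in>weighted_L1 \<omega>1.
           weighted_L1_norm \<omega>2 (hardy_cesaro \<psi> f) \<le> C * weighted_L1_norm \<omega>1 f"
    using bounded unfolding hardy_cesaro_bounded_def by blast
  let ?k = "\<lambda>s. hardy_kernel \<psi> \<omega>2 s * indicator {0..} s"
  let ?v = "\<lambda>s. ennreal (\<bar>C\<bar> * \<omega>1 s) * indicator {0..} s"
  have v: "?v \<in> borel_measurable borel"
  proof -
    note [measurable] = borel_measurable_weight[OF \<omega>1]
    have "(\<lambda>s. ennreal \<bar>C\<bar> * (ennreal (\<omega>1 s) * indicator {0..} s)) \<in> borel_measurable borel"
      by measurable
    then show ?thesis by (simp add: ennreal_mult' mult.assoc)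
  qed
  have restr: "(a * indicator {0..} s) * indicator A s = a * (indicator A s :: ennreal)"
    if "A \<subseteq> {0..n}" for a A n and s :: real
    using that by (auto simp: indicator_def)
  have "AE s in lborel. 0 \<le> s \<longrightarrow> ?k s \<le> ?v s"
  proof (rule AE_le_if_nn_integral_le_on_bounded_sets[OF borel_measurable_kernel[OF p \<omega>2] v])
    fix A n assume A: "A \<in> sets borel" "A \<subseteq> {0..n::real}"
    note * = nn_integral_kernel_le_on_bounded_set[OF p \<omega>1 \<omega>2 bounded C A]
    show "(\<integral>\<^sup>+s. ?k s * indicator A s \<partial>lborel) \<le> (\<integral>\<^sup>+s. ?v s * indicator A s \<partial>lborel)"
      "(\<integral>\<^sup>+s. ?v s * indicator A s \<partial>lborel) < \<infinity>"
      unfolding restr[OF A(2)] using * by simp_all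
  qed
  then have ae: "AE s in lborel. 0 \<le> s \<longrightarrow> hardy_kernel \<psi> \<omega>2 s \<le> ennreal (\<bar>C\<bar> * \<omega>1 s)"
    by eventually_elim auto
  have "hardy_kernel \<psi> \<omega>2 s \<le> ennreal (\<bar>C\<bar> * \<omega>1 s)" if s: "0 \<le> s" for s
  proof -
    obtain u where u: "\<And>n::nat. 0 \<le> u n" "\<And>n. hardy_kernel \<psi> \<omega>2 (u n) \<le> ennreal (\<bar>C\<bar> * \<omega>1 (u n))"
      "u \<longlonglongrightarrow> s"
      using AE_nonneg_approximants[OF ae s] by metis
    have "(\<lambda>n. \<omega>1 (u n)) \<longlonglongrightarrow> \<omega>1 s"
      using u s by (intro continuous_on_tendsto_compose[OF weight_continuous[OF \<omega>1]]) auto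
    then have lim: "(\<lambda>n. ennreal (\<bar>C\<bar> * \<omega>1 (u n))) \<longlonglongrightarrow> ennreal (\<bar>C\<bar> * \<omega>1 s)"
      by (intro tendsto_intros)
    have "hardy_kernel \<psi> \<omega>2 s \<le> liminf (\<lambda>n. hardy_kernel \<psi> \<omega>2 (u n))"
      by (rule kernel_le_liminf[OF p \<omega>2 u(1,3)])
    also have "\<dots> \<le> liminf (\<lambda>n. ennreal (\<bar>C\<bar> * \<omega>1 (u n)))"
      using u(2) by (intro Liminf_mono) auto
    also have "\<dots> = ennreal (\<bar>C\<bar> * \<omega>1 s)"
      using lim by (intro lim_imp_Liminf) auto
    finally show ?thesis .
  qed
  then show ?thesis by (intro exI[of _ "\<bar>C\<bar>"]) auto
qed

section \<open>The characterization\<close>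

theorem theorem2p1:
  fixes \<psi> \<omega>1 \<omega>2 :: "real \<Rightarrow> real"
  assumes "\<psi> \<in> borel_measurable (lebesgue_on {0..1})"
    and "\<And>t. t \<in> {0..1} \<Longrightarrow> 0 \<le> \<psi> t"
    and "continuous_on {0..} \<omega>1" and "\<And>s. 0 \<le> s \<Longrightarrow> 0 < \<omega>1 s"
    and "continuous_on {0..} \<omega>2" and "\<And>s. 0 \<le> s \<Longrightarrow> 0 < \<omega>2 s"
  shows "hardy_cesaro_bounded \<psi> \<omega>1 \<omega>2 \<longleftrightarrow>
    (\<exists>C::real. C \<ge> 0 \<and>
      (\<forall>s\<ge>0. (\<integral>\<^sup>+ t. ennreal (\<omega>2 (s / t) * (\<psi> t / t)) \<partial>lebesgue_on {0..1})
               \<le> ennreal (C * \<omega>1 s)))"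
proof -
  have \<omega>: "weight \<omega>1" "weight \<omega>2" using assms(3-6) by (auto simp: weight_def)
  have \<psi>: "\<forall>t\<in>{0..1}. 0 \<le> \<psi> t" using assms(2) by blast
  show ?thesis
    using kernel_le_if_hardy_cesaro_bounded[OF assms(1) \<psi> \<omega>]
      hardy_cesaro_bounded_if_kernel_le[OF assms(1) \<psi> \<omega>]
    unfolding hardy_kernel_def by blast
qed

end
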